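(* In the binary random graph affiliation mixture model with uniform group priors $\pi_q=1/Q$ and $\alpha\ne\beta$, the parameters $\alpha$, $\beta$ and the number of groups $Q\ge2$ are identifiable from the joint distribution of $K_4$: any two parameter triples $(Q,\alpha,\beta)$, $(Q',\alpha',\beta')$ (with $\alpha\ne\beta$, $\alpha'\ne\beta'$) inducing the same law of $K_4$ are equal.
   Context: Random graph mixture model: nodes have i.i.d. latent groups $Z_i\in\{1,\dots,Q\}$ with $\pi_q=\mathbb P(Z_i=q)$; edge variables $X_{ij}$ ($i<j$) are conditionally independent given all $Z$'s, with law of $X_{ij}$ depending only on $(Z_i,Z_j)$. Binary affiliation model: $X_{ij}\in\{0,1\}$ with $\mathbb P(X_{ij}=1\mid Z_i=q,Z_j=l)=\alpha$ if $q=l$ and $=\beta$ if $q\ne l$. $K_n$ denotes the collection of the $\binom n2$ edge variables among a set of $n$ nodes. *)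

theory Defs
  imports Complex_Main "HOL-Library.FuncSet"
begin

definition aff_prob :: "real \<Rightarrow> real \<Rightarrow> nat \<Rightarrow> nat \<Rightarrow> real" where
  "aff_prob \<alpha> \<beta> q l = (if q = l then \<alpha> else \<beta>)"

text \<open>Probability that the edge variables X_ij (i<j<n) of K_n take the values
  x i j, obtained by summing over all latent group assignments z of the n nodes.\<close>

definition K_law :: "nat \<Rightarrow> nat \<Rightarrow> real \<Rightarrow> real \<Rightarrow> (nat \<Rightarrow> nat \<Rightarrow> bool) \<Rightarrow> real" where
  "K_law n Q \<alpha> \<beta> x =
     (\<Sum>z \<in> {..<n} \<rightarrow>\<^sub>E {..<Q}.
        (\<Prod>i<n. 1 / real Q) *
        (\<Prod>(i,j) \<in> {(i,j). i < j \<and> j < n}.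
           if x i j then aff_prob \<alpha> \<beta> (z i) (z j) else 1 - aff_prob \<alpha> \<beta> (z i) (z j)))"

end

theory Submission
  imports Defs
begin

(* Write p = 1/Q, a = alpha - beta, b = beta.  Three events suffice: the probability that
   one edge, a triangle, and a 4-cycle are all present.  In the affiliation model these are
     m1 = b + a p,   m3 = m1^3 + a^3 p^2 (1 - p),   m4 = m1^4 + a^4 p^3 (1 - p),
   and (a, p, b) can be recovered from (m1, m3, m4) whenever a ~= 0 and 0 < p < 1:
   t3 = m3 - m1^3 and t4 = m4 - m1^4 give a p = t4 / t3, then a (1 - p) = t3 / (a p)^2.
   The file first introduces the marginal law of the edge variables on a subset E of the
   edges of K_n and shows that it is obtained from the full law by summing out edges, so
   equal laws of K_n have equal marginals on every edge set. *)

lemma sum_PiE_insert: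
  assumes "x \<notin> S"
  shows "(\<Sum>z\<in>Pi\<^sub>E (insert x S) T. f z) = (\<Sum>y\<in>T x. \<Sum>g\<in>Pi\<^sub>E S T. f (g(x := y)))"
proof -
  have "(\<Sum>z\<in>Pi\<^sub>E (insert x S) T. f z) = (\<Sum>z\<in>(\<lambda>(y, g). g(x := y)) ` (T x \<times> Pi\<^sub>E S T). f z)"
    by (simp add: PiE_insert_eq)
  also have "\<dots> = (\<Sum>(y,g)\<in>T x \<times> Pi\<^sub>E S T. f (g(x := y)))"
    by (subst sum.reindex[OF inj_combinator[OF assms]]) (simp add: case_prod_unfold)
  also have "\<dots> = (\<Sum>y\<in>T x. \<Sum>g\<in>Pi\<^sub>E S T. f (g(x := y)))"
    by (rule sum.cartesian_product[symmetric])
  finally show ?thesis .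
qed

lemma sum_assignments_4:
  "(\<Sum>z\<in>{..<4::nat}\<rightarrow>\<^sub>E{..<Q}. f (z 0) (z 1) (z 2) (z 3)) =
   (\<Sum>d<Q. \<Sum>c<Q. \<Sum>b<Q. \<Sum>a<Q. (f a b c d :: real))"
proof -
  have "{..<4::nat} = insert 3 (insert 2 (insert 1 (insert 0 {})))" by auto
  then show ?thesis by (simp add: sum_PiE_insert)
qed

lemma sum_one_exception:
  assumes "a < Q"
  shows "(\<Sum>c<Q. if c = a then A else B) = A + (real Q - 1) * (B::real)"
proof -
  have "(\<Sum>c<Q. if c = a then A else B) = (\<Sum>c<Q. B + (if c = a then A - B else 0))"
    by (intro sum.cong) auto
  also have "\<dots> = real Q * B + (A - B)" using assms by (simp add: sum.distrib)
  finally show ?thesis by (simp add: algebra_simps)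
qed

lemma sum_two_exceptions:
  assumes "a < Q" "b < Q" "a \<noteq> b"
  shows "(\<Sum>c<Q. if c = a then A else if c = b then B else C) = A + B + (real Q - 2) * (C::real)"
proof -
  have "(\<Sum>c<Q. if c = a then A else if c = b then B else C) =
        (\<Sum>c<Q. C + (if c = a then A - C else 0) + (if c = b then B - C else 0))"
    using assms by (intro sum.cong) auto
  also have "\<dots> = real Q * C + (A - C) + (B - C)" using assms by (simp add: sum.distrib)
  finally show ?thesis by (simp add: algebra_simps)
qed

lemma neighbour_sum:
  "b < Q \<Longrightarrow> (\<Sum>a<Q. aff_prob \<alpha> \<beta> a b) = \<alpha> + (real Q - 1) * \<beta>"
  unfolding aff_prob_def using sum_one_exception by simp

lemma common_neighbour_sum:
  assumes "b < Q" "c < Q"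
  shows "(\<Sum>a<Q. aff_prob \<alpha> \<beta> a b * aff_prob \<alpha> \<beta> a c) =
    (if b = c then \<alpha>^2 + (real Q - 1) * \<beta>^2 else 2*\<alpha>*\<beta> + (real Q - 2) * \<beta>^2)"
proof (cases "b = c")
  case True
  have "(\<Sum>a<Q. aff_prob \<alpha> \<beta> a b * aff_prob \<alpha> \<beta> a c) = (\<Sum>a<Q. if a = b then \<alpha>^2 else \<beta>^2)"
    using True by (intro sum.cong) (auto simp: aff_prob_def power2_eq_square)
  then show ?thesis using True assms sum_one_exception by simp
next
  case False
  have "(\<Sum>a<Q. aff_prob \<alpha> \<beta> a b * aff_prob \<alpha> \<beta> a c) =
     (\<Sum>a<Q. if a = b then \<alpha>*\<beta> else if a = c then \<beta>*\<alpha> else \<beta>^2)"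
    using False by (intro sum.cong) (auto simp: aff_prob_def power2_eq_square)
  then show ?thesis using False assms sum_two_exceptions[of b Q c] by simp
qed

section \<open>Marginal laws on edge subsets\<close>

definition edges :: "nat \<Rightarrow> (nat \<times> nat) set" where
  "edges n = {(i,j). i < j \<and> j < n}"

definition edge_marginal ::
    "nat \<Rightarrow> nat \<Rightarrow> real \<Rightarrow> real \<Rightarrow> (nat \<times> nat) set \<Rightarrow> (nat \<Rightarrow> nat \<Rightarrow> bool) \<Rightarrow> real" where
  "edge_marginal n Q \<alpha> \<beta> E x = (\<Sum>z \<in> {..<n} \<rightarrow>\<^sub>E {..<Q}.
        (\<Prod>i<n. 1 / real Q) *
        (\<Prod>(i,j) \<in> E.
           if x i j then aff_prob \<alpha> \<beta> (z i) (z j) else 1 - aff_prob \<alpha> \<beta> (z i) (z j)))"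

lemma K_law_edge_marginal: "K_law n Q \<alpha> \<beta> x = edge_marginal n Q \<alpha> \<beta> (edges n) x"
  unfolding K_law_def edge_marginal_def edges_def by simp

(* K_n has finitely many edges, so the edges outside E can be summed out one at a time. *)
lemma finite_edges: "finite (edges n)"
  by (rule finite_subset[of _ "{..<n} \<times> {..<n}"]) (auto simp: edges_def)

lemma edge_marginal_sum_out:
  assumes "finite E" "(i,j) \<in> E"
  shows "edge_marginal n Q \<alpha> \<beta> E (x(i := (x i)(j := True)))
       + edge_marginal n Q \<alpha> \<beta> E (x(i := (x i)(j := False)))
       = edge_marginal n Q \<alpha> \<beta> (E - {(i,j)}) x"
proof -
  let ?g = "\<lambda>y z. (\<lambda>(i',j'). if y i' j' then aff_prob \<alpha> \<beta> (z i') (z j')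
                                          else 1 - aff_prob \<alpha> \<beta> (z i') (z j'))"
  let ?c = "\<Prod>i<n. 1 / real Q"
  have rest: "prod (?g (x(i := (x i)(j := b))) z) (E - {(i,j)}) = prod (?g x z) (E - {(i,j)})"
    for b z by (intro prod.cong) (auto split: if_splits)
  have split: "prod (?g y z) E = ?g y z (i,j) * prod (?g y z) (E - {(i,j)})" for y z
    using prod.remove[OF assms] by blast
  have present: "?g (x(i := (x i)(j := True))) z (i,j) = aff_prob \<alpha> \<beta> (z i) (z j)"
    and absent: "?g (x(i := (x i)(j := False))) z (i,j) = 1 - aff_prob \<alpha> \<beta> (z i) (z j)" for z
    by simp_all
  have "?c * prod (?g (x(i := (x i)(j := True))) z) E
      + ?c * prod (?g (x(i := (x i)(j := False))) z) E
      = ?c * prod (?g x z) (E - {(i,j)})" for z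
    unfolding split[of "x(i := (x i)(j := True))"] split[of "x(i := (x i)(j := False))"]
      present absent rest
    by (simp add: algebra_simps)
  then show ?thesis
    unfolding edge_marginal_def sum.distrib[symmetric] by (intro sum.cong refl)
qed

lemma edge_marginal_eq_Diff:
  assumes "\<forall>x. edge_marginal n Q \<alpha> \<beta> E x = edge_marginal n Q' \<alpha>' \<beta>' E x"
    and "finite E" "finite F" "F \<subseteq> E"
  shows "\<forall>x. edge_marginal n Q \<alpha> \<beta> (E - F) x = edge_marginal n Q' \<alpha>' \<beta>' (E - F) x"
  using assms(3,4)
proof (induction F rule: finite_induct)
  case empty
  then show ?case using assms(1) by simp
next
  case (insert e F)
  obtain i j where e: "e = (i,j)" by (cases e)
  have fin: "finite (E - F)" using assms(2) by simp
  have mem: "(i,j) \<in> E - F" using insert e by auto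
  have "E - insert e F = (E - F) - {(i,j)}" using e by auto
  then show ?case
    using edge_marginal_sum_out[OF fin mem, symmetric] insert by simp
qed

lemma edge_marginal_eq:
  assumes "\<forall>x. K_law n Q \<alpha> \<beta> x = K_law n Q' \<alpha>' \<beta>' x" and "E \<subseteq> edges n"
  shows "edge_marginal n Q \<alpha> \<beta> E x = edge_marginal n Q' \<alpha>' \<beta>' E x"
proof -
  have "\<forall>x. edge_marginal n Q \<alpha> \<beta> (edges n) x = edge_marginal n Q' \<alpha>' \<beta>' (edges n) x"
    using assms(1) by (simp add: K_law_edge_marginal)
  from edge_marginal_eq_Diff[OF this finite_edges, of "edges n - E"]
  have "\<forall>x. edge_marginal n Q \<alpha> \<beta> (edges n - (edges n - E)) x
          = edge_marginal n Q' \<alpha>' \<beta>' (edges n - (edges n - E)) x"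
    using finite_edges by simp
  moreover have "edges n - (edges n - E) = E" using assms(2) by auto
  ultimately show ?thesis by simp
qed

section \<open>Subgraph probabilities on K_4\<close>

(* Polynomial identities turning the triangle and 4-cycle probabilities, as obtained by
   summing out the groups (rational functions of the number q of groups), into the
   form m1^k + a^k p^(k-1) (1 - p) used for the inversion, with p = 1/q and a = alpha - beta. *)
lemma triangle_closed_form:
  fixes q :: real
  assumes "q > 0"
  shows "(\<alpha> * (\<alpha>^2 + (q - 1) * \<beta>^2) + (q - 1) * (\<beta> * (2*\<alpha>*\<beta> + (q - 2) * \<beta>^2))) / q^2
    = (\<beta> + (\<alpha> - \<beta>) * (1/q))^3 + (\<alpha> - \<beta>)^3 * (1/q)^2 * (1 - 1/q)"
  using assms by (simp add: field_simps power3_eq_cube power2_eq_square)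

lemma square_closed_form:
  fixes q :: real
  assumes "q > 0"
  shows "((\<alpha>^2 + (q - 1) * \<beta>^2)^2 + (q - 1) * (2*\<alpha>*\<beta> + (q - 2) * \<beta>^2)^2) / q^3
    = (\<beta> + (\<alpha> - \<beta>) * (1/q))^4 + (\<alpha> - \<beta>)^4 * (1/q)^3 * (1 - 1/q)"
  using assms by (simp add: field_simps power4_eq_xxxx power3_eq_cube power2_eq_square)

lemma edge_probability:
  assumes "Q \<ge> 1"
  defines "p \<equiv> 1 / real Q"
  shows "edge_marginal 4 Q \<alpha> \<beta> {(0,1)} (\<lambda>_ _. True) = \<beta> + (\<alpha> - \<beta>) * p"
proof -
  let ?K = "(1 / real Q)^4"
  have "edge_marginal 4 Q \<alpha> \<beta> {(0,1)} (\<lambda>_ _. True) =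
    (\<Sum>z\<in>{..<4::nat}\<rightarrow>\<^sub>E{..<Q}.
       (\<lambda>a b c d. ?K * aff_prob \<alpha> \<beta> a b) (z 0) (z 1) (z 2) (z 3))"
    unfolding edge_marginal_def by simp
  also have "\<dots> = (\<Sum>d<Q. \<Sum>c<Q. \<Sum>b<Q. \<Sum>a<Q. ?K * aff_prob \<alpha> \<beta> a b)"
    by (rule sum_assignments_4)
  also have "\<dots> = (\<Sum>d<Q. \<Sum>c<Q. \<Sum>b<Q. ?K * (\<alpha> + (real Q - 1) * \<beta>))"
    by (simp add: sum_distrib_left[symmetric] neighbour_sum)
  also have "\<dots> = \<beta> + (\<alpha> - \<beta>) * p"
    using assms by (simp add: power4_eq_xxxx field_simps)
  finally show ?thesis .
qed

lemma triangle_probability: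
  assumes "Q \<ge> 1"
  defines "p \<equiv> 1 / real Q"
  shows "edge_marginal 4 Q \<alpha> \<beta> {(0,1),(0,2),(1,2)} (\<lambda>_ _. True) =
    (\<beta> + (\<alpha> - \<beta>) * p)^3 + (\<alpha> - \<beta>)^3 * p^2 * (1 - p)"
proof -
  let ?K = "(1 / real Q)^4"
  let ?s1 = "\<alpha>^2 + (real Q - 1) * \<beta>^2" and ?s2 = "2*\<alpha>*\<beta> + (real Q - 2) * \<beta>^2"
  have "edge_marginal 4 Q \<alpha> \<beta> {(0,1),(0,2),(1,2)} (\<lambda>_ _. True) =
    (\<Sum>z\<in>{..<4::nat}\<rightarrow>\<^sub>E{..<Q}. (\<lambda>a b c d. ?K * aff_prob \<alpha> \<beta> b c *
       (aff_prob \<alpha> \<beta> a b * aff_prob \<alpha> \<beta> a c)) (z 0) (z 1) (z 2) (z 3))"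
    unfolding edge_marginal_def by (simp add: mult_ac)
  also have "\<dots> = (\<Sum>d<Q. \<Sum>c<Q. \<Sum>b<Q. \<Sum>a<Q.
      ?K * aff_prob \<alpha> \<beta> b c * (aff_prob \<alpha> \<beta> a b * aff_prob \<alpha> \<beta> a c))"
    by (rule sum_assignments_4)
  also have "\<dots> = (\<Sum>d<Q. \<Sum>c<Q. \<Sum>b<Q. ?K * (if b = c then \<alpha> * ?s1 else \<beta> * ?s2))"
    by (intro sum.cong refl)
       (simp add: sum_distrib_left[symmetric] common_neighbour_sum, simp add: aff_prob_def)
  also have "\<dots> = (\<Sum>d<Q. \<Sum>c<Q. ?K * (\<alpha> * ?s1 + (real Q - 1) * (\<beta> * ?s2)))"
    by (intro sum.cong refl) (simp add: sum_distrib_left[symmetric] sum_one_exception)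
  also have "\<dots> = (\<alpha> * ?s1 + (real Q - 1) * (\<beta> * ?s2)) / real Q^2"
    using assms by (simp add: power4_eq_xxxx power2_eq_square field_simps)
  also have "\<dots> = (\<beta> + (\<alpha> - \<beta>) * p)^3 + (\<alpha> - \<beta>)^3 * p^2 * (1 - p)"
    unfolding p_def using assms by (intro triangle_closed_form) simp
  finally show ?thesis .
qed

lemma square_probability:
  assumes "Q \<ge> 1"
  defines "p \<equiv> 1 / real Q"
  shows "edge_marginal 4 Q \<alpha> \<beta> {(0,2),(1,2),(1,3),(0,3)} (\<lambda>_ _. True) =
    (\<beta> + (\<alpha> - \<beta>) * p)^4 + (\<alpha> - \<beta>)^4 * p^3 * (1 - p)"
proof -
  let ?K = "(1 / real Q)^4"
  let ?s1 = "\<alpha>^2 + (real Q - 1) * \<beta>^2" and ?s2 = "2*\<alpha>*\<beta> + (real Q - 2) * \<beta>^2"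
  have "edge_marginal 4 Q \<alpha> \<beta> {(0,2),(1,2),(1,3),(0,3)} (\<lambda>_ _. True) =
    (\<Sum>z\<in>{..<4::nat}\<rightarrow>\<^sub>E{..<Q}. (\<lambda>a b c d. ?K * (aff_prob \<alpha> \<beta> b c * aff_prob \<alpha> \<beta> b d) *
       (aff_prob \<alpha> \<beta> a c * aff_prob \<alpha> \<beta> a d)) (z 0) (z 1) (z 2) (z 3))"
    unfolding edge_marginal_def by (simp add: mult_ac)
  also have "\<dots> = (\<Sum>d<Q. \<Sum>c<Q. \<Sum>b<Q. \<Sum>a<Q. ?K * (aff_prob \<alpha> \<beta> b c * aff_prob \<alpha> \<beta> b d) *
      (aff_prob \<alpha> \<beta> a c * aff_prob \<alpha> \<beta> a d))"
    by (rule sum_assignments_4)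
  also have "\<dots> = (\<Sum>d<Q. \<Sum>c<Q. ?K * (if c = d then ?s1 * ?s1 else ?s2 * ?s2))"
    by (intro sum.cong refl)
       (simp add: sum_distrib_left[symmetric] sum_distrib_right[symmetric] common_neighbour_sum)
  also have "\<dots> = (\<Sum>d<Q. ?K * (?s1 * ?s1 + (real Q - 1) * (?s2 * ?s2)))"
    by (intro sum.cong refl) (simp add: sum_distrib_left[symmetric] sum_one_exception)
  also have "\<dots> = (?s1^2 + (real Q - 1) * ?s2^2) / real Q^3"
    using assms by (simp add: power4_eq_xxxx power2_eq_square power3_eq_cube field_simps)
  also have "\<dots> = (\<beta> + (\<alpha> - \<beta>) * p)^4 + (\<alpha> - \<beta>)^4 * p^3 * (1 - p)"
    unfolding p_def using assms by (intro square_closed_form) simp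
  finally show ?thesis .
qed

section \<open>Inverting the subgraph probabilities\<close>

(* The map (a, p, b) |-> (m1, m3, m4) is injective for a ~= 0 and 0 < p < 1: the cubic and
   quartic excesses t3 = a^3 p^2 (1-p), t4 = a^4 p^3 (1-p) satisfy t4 = (a p) t3, which gives
   a p; then t3 = (a p)^2 (a - a p) gives a, hence p, and m1 gives b. *)
lemma subgraph_moments_injective:
  fixes a b p a' b' p' :: real
  assumes "0 < p" "p < 1" "0 < p'" "p' < 1" "a \<noteq> 0" "a' \<noteq> 0"
    and m1: "b + a * p = b' + a' * p'"
    and m3: "(b + a * p)^3 + a^3 * p^2 * (1 - p) = (b' + a' * p')^3 + a'^3 * p'^2 * (1 - p')"
    and m4: "(b + a * p)^4 + a^4 * p^3 * (1 - p) = (b' + a' * p')^4 + a'^4 * p'^3 * (1 - p')"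
  shows "a = a' \<and> p = p' \<and> b = b'"
proof -
  define t where "t = a^3 * p^2 * (1 - p)"
  have t': "t = a'^3 * p'^2 * (1 - p')" using m1 m3 unfolding t_def by simp
  have "t \<noteq> 0" unfolding t_def using assms by simp
  have "(a*p) * t = a^4 * p^3 * (1 - p)" unfolding t_def
    by (simp add: power3_eq_cube power4_eq_xxxx power2_eq_square algebra_simps)
  also have "\<dots> = a'^4 * p'^3 * (1 - p')" using m1 m4 by simp
  also have "\<dots> = (a'*p') * t" unfolding t'
    by (simp add: power3_eq_cube power4_eq_xxxx power2_eq_square algebra_simps)
  finally have ap: "a * p = a' * p'" using \<open>t \<noteq> 0\<close> by simp
  have "(a*p)^2 * (a - a*p) = t" unfolding t_def
    by (simp add: power3_eq_cube power2_eq_square algebra_simps)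
  moreover have "(a*p)^2 * (a' - a*p) = t" unfolding t' ap
    by (simp add: power3_eq_cube power2_eq_square algebra_simps)
  ultimately have eq: "(a*p)^2 * (a - a*p) = (a*p)^2 * (a' - a*p)" by simp
  have "(a*p)^2 \<noteq> 0" using assms by simp
  from iffD1[OF mult_left_cancel[OF this] eq] have "a = a'" by simp
  moreover have "p = p'" using ap \<open>a = a'\<close> assms by simp
  ultimately show ?thesis using m1 by simp
qed

lemma equal_K4_laws_subgraph_moments:
  fixes \<alpha> \<beta> \<alpha>' \<beta>' :: real
  assumes "Q \<ge> 1" "Q' \<ge> 1" and "\<forall>x. K_law 4 Q \<alpha> \<beta> x = K_law 4 Q' \<alpha>' \<beta>' x"
  defines "p \<equiv> 1 / real Q" and "p' \<equiv> 1 / real Q'"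
  shows "\<beta> + (\<alpha> - \<beta>) * p = \<beta>' + (\<alpha>' - \<beta>') * p'"
    and "(\<beta> + (\<alpha> - \<beta>) * p)^3 + (\<alpha> - \<beta>)^3 * p^2 * (1 - p)
       = (\<beta>' + (\<alpha>' - \<beta>') * p')^3 + (\<alpha>' - \<beta>')^3 * p'^2 * (1 - p')"
    and "(\<beta> + (\<alpha> - \<beta>) * p)^4 + (\<alpha> - \<beta>)^4 * p^3 * (1 - p)
       = (\<beta>' + (\<alpha>' - \<beta>') * p')^4 + (\<alpha>' - \<beta>')^4 * p'^3 * (1 - p')"
proof -
  have "{(0,1)} \<subseteq> edges 4" by (auto simp: edges_def)
  from edge_marginal_eq[OF assms(3) this, of "\<lambda>_ _. True"]
  show "\<beta> + (\<alpha> - \<beta>) * p = \<beta>' + (\<alpha>' - \<beta>') * p'"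
    unfolding edge_probability[OF assms(1)] edge_probability[OF assms(2)] p_def p'_def .
  have "{(0,1),(0,2),(1,2)} \<subseteq> edges 4" by (auto simp: edges_def)
  from edge_marginal_eq[OF assms(3) this, of "\<lambda>_ _. True"]
  show "(\<beta> + (\<alpha> - \<beta>) * p)^3 + (\<alpha> - \<beta>)^3 * p^2 * (1 - p)
      = (\<beta>' + (\<alpha>' - \<beta>') * p')^3 + (\<alpha>' - \<beta>')^3 * p'^2 * (1 - p')"
    unfolding triangle_probability[OF assms(1)] triangle_probability[OF assms(2)] p_def p'_def .
  have "{(0,2),(1,2),(1,3),(0,3)} \<subseteq> edges 4" by (auto simp: edges_def)
  from edge_marginal_eq[OF assms(3) this, of "\<lambda>_ _. True"]
  show "(\<beta> + (\<alpha> - \<beta>) * p)^4 + (\<alpha> - \<beta>)^4 * p^3 * (1 - p)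
      = (\<beta>' + (\<alpha>' - \<beta>') * p')^4 + (\<alpha>' - \<beta>')^4 * p'^3 * (1 - p')"
    unfolding square_probability[OF assms(1)] square_probability[OF assms(2)] p_def p'_def .
qed

theorem corollary3:
  fixes Q Q' :: nat and \<alpha> \<beta> \<alpha>' \<beta>' :: real
  assumes "Q \<ge> 2" and "Q' \<ge> 2"
    and "0 \<le> \<alpha>" "\<alpha> \<le> 1" "0 \<le> \<beta>" "\<beta> \<le> 1"
    and "0 \<le> \<alpha>'" "\<alpha>' \<le> 1" "0 \<le> \<beta>'" "\<beta>' \<le> 1"
    and "\<alpha> \<noteq> \<beta>" and "\<alpha>' \<noteq> \<beta>'"
    and "\<forall>x. K_law 4 Q \<alpha> \<beta> x = K_law 4 Q' \<alpha>' \<beta>' x"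
  shows "Q = Q' \<and> \<alpha> = \<alpha>' \<and> \<beta> = \<beta>'"
proof -
  have "Q \<ge> 1" "Q' \<ge> 1" using assms(1,2) by auto
  note moments = equal_K4_laws_subgraph_moments[OF this assms(13)]
  have p: "0 < 1 / real Q" "1 / real Q < 1" "0 < 1 / real Q'" "1 / real Q' < 1"
    using assms(1,2) by auto
  have a: "\<alpha> - \<beta> \<noteq> 0" "\<alpha>' - \<beta>' \<noteq> 0" using assms(11,12) by simp_all
  have "\<alpha> - \<beta> = \<alpha>' - \<beta>' \<and> 1 / real Q = 1 / real Q' \<and> \<beta> = \<beta>'"
    using subgraph_moments_injective[OF p a moments] .
  then show ?thesis by simp
qed

end
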